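(* Let $G$ be a finite simple bipartite graph with $v(G)$ vertices and $e(G)$ edges. Then the nim-value $g(G)$ of $G$ in graph chomp is: $0$ if $v(G)$ and $e(G)$ are both even; $2$ if $v(G)$ is even and $e(G)$ is odd; $1$ if $v(G)$ is odd and $e(G)$ is even; $3$ if $v(G)$ and $e(G)$ are both odd.
   Context: A graph is bipartite if its vertex set can be split into two groups so that no edge joins two vertices of the same group. Graph chomp is played on a finite simple graph: two players alternate, and a move consists either of deleting one edge, or of deleting one vertex together with all edges incident to it. The player who makes the last move wins. The nim-value $g$ of a position is defined recursively: the empty graph has nim-value $0$, and $g(G)$ is the minimal nonnegative integer not equal to the nim-value of any position reachable from $G$ in one move. *)

theory Defs
  imports Main
begin

(* A graph is its vertex set together with its edge set; an edge is the 2-element set of its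
   endpoints. *)
type_synonym 'a graph = "'a set \<times> 'a set set"

abbreviation verts :: "'a graph \<Rightarrow> 'a set" where "verts \<equiv> fst"
abbreviation edges :: "'a graph \<Rightarrow> 'a set set" where "edges \<equiv> snd"

definition finite_simple_graph :: "'a graph \<Rightarrow> bool" where
  "finite_simple_graph G \<longleftrightarrow>
     finite (verts G) \<and> (\<forall>e\<in>edges G. e \<subseteq> verts G \<and> card e = 2)"

definition bipartite :: "'a graph \<Rightarrow> bool" where
  "bipartite G \<longleftrightarrow>
     (\<exists>A B. A \<union> B = verts G \<and> A \<inter> B = {} \<and> (\<forall>e\<in>edges G. \<not> e \<subseteq> A \<and> \<not> e \<subseteq> B))"

definition delete_edge :: "'a graph \<Rightarrow> 'a set \<Rightarrow> 'a graph" where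
  "delete_edge G e = (verts G, edges G - {e})"

definition delete_vertex :: "'a graph \<Rightarrow> 'a \<Rightarrow> 'a graph" where
  "delete_vertex G v = (verts G - {v}, {e \<in> edges G. v \<notin> e})"

definition chomp_moves :: "'a graph \<Rightarrow> 'a graph set" where
  "chomp_moves G = delete_edge G ` edges G \<union> delete_vertex G ` verts G"

definition mex :: "nat set \<Rightarrow> nat" where
  "mex S = (LEAST n. n \<notin> S)"

lemma finite_edges: "finite_simple_graph G \<Longrightarrow> finite (edges G)"
  unfolding finite_simple_graph_def by (auto intro: finite_subset[of _ "Pow (verts G)"])

lemma finite_simple_graph_chomp_moves:
  assumes "finite_simple_graph G" "H \<in> chomp_moves G"
  shows "finite_simple_graph H"
  using assms
  unfolding finite_simple_graph_def chomp_moves_def delete_edge_def delete_vertex_def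
  by fastforce

lemma chomp_moves_decrease:
  assumes "finite_simple_graph G" "H \<in> chomp_moves G"
  shows "card (verts H) + card (edges H) < card (verts G) + card (edges G)"
proof -
  have V: "finite (verts G)" and E: "finite (edges G)"
    using assms(1) finite_edges[OF assms(1)] by (simp_all add: finite_simple_graph_def)
  from assms(2) consider
      e where "e \<in> edges G" "H = delete_edge G e"
    | v where "v \<in> verts G" "H = delete_vertex G v"
    by (auto simp: chomp_moves_def)
  then show ?thesis
  proof cases
    case 1
    then show ?thesis
      using card_Diff1_less[OF E 1(1)] by (simp add: delete_edge_def)
  next
    case 2
    have "card {e \<in> edges G. v \<notin> e} \<le> card (edges G)"
      by (rule card_mono[OF E]) auto
    then show ?thesis
      using card_Diff1_less[OF V 2(1)] 2(2) by (simp add: delete_vertex_def)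
  qed
qed

(* Outside finite simple graphs the value is a dummy; by finite_simple_graph_chomp_moves the
   recursion never leaves that class. *)
function nim_value :: "'a graph \<Rightarrow> nat" where
  "nim_value G =
     (if finite_simple_graph G then mex (nim_value ` chomp_moves G) else 0)"
  by auto
termination
  by (relation "measure (\<lambda>G. card (verts G) + card (edges G))")
     (auto dest: chomp_moves_decrease)

declare nim_value.simps [simp del]

lemma nim_value_rec:
  "finite_simple_graph G \<Longrightarrow> nim_value G = mex (nim_value ` chomp_moves G)"
  by (subst nim_value.simps) simp

lemma nim_value_empty: "nim_value ({}, {}) = 0"
  by (subst nim_value.simps)
     (simp add: finite_simple_graph_def chomp_moves_def mex_def)

end

(* The claimed value is v(G) mod 2 + 2 * (e(G) mod 2).  Every move flips the parity of v or of e,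
   so no move preserves this number, and it remains to reach each smaller value.  If e is odd,
   deleting an edge lowers the value by 2.  If v is odd, the handshake lemma gives a vertex of
   even degree.  If e is odd, the degrees in one part of the bipartition sum to e, so that part
   contains a vertex of odd degree.  Deleting these vertices yields the other values. *)
theory Submission
  imports Defs
begin

definition degree :: "'a graph \<Rightarrow> 'a \<Rightarrow> nat" where
  "degree G v = card {e \<in> edges G. v \<in> e}"

text \<open>Double counting of the incidences between \<open>S\<close> and the edges. An arbitrary
  \<open>S\<close> allows both uses: all vertices for the handshake lemma, one side of the
  bipartition for odd degrees.\<close>

lemma sum_degree:
  assumes "finite_simple_graph G" "S \<subseteq> verts G"
  shows "(\<Sum>v\<in>S. degree G v) = (\<Sum>e\<in>edges G. card (e \<inter> S))"
proof -
  have S: "finite S" and E: "finite (edges G)"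
    using assms finite_edges[OF assms(1)] by (auto simp: finite_simple_graph_def intro: finite_subset)
  have "(\<Sum>v\<in>S. degree G v) = (\<Sum>v\<in>S. \<Sum>e\<in>edges G. if v \<in> e then 1 else 0)"
    by (simp add: degree_def sum.If_cases[OF E] Int_def)
  also have "\<dots> = (\<Sum>e\<in>edges G. \<Sum>v\<in>S. if v \<in> e then 1 else 0)"
    by (rule sum.swap)
  also have "\<dots> = (\<Sum>e\<in>edges G. card (e \<inter> S))"
    by (simp add: sum.If_cases[OF S] Int_def conj_commute)
  finally show ?thesis .
qed

lemma handshake:
  assumes "finite_simple_graph G"
  shows "(\<Sum>v\<in>verts G. degree G v) = 2 * card (edges G)"
proof -
  have "card (e \<inter> verts G) = 2" if "e \<in> edges G" for e
    using assms that by (simp add: finite_simple_graph_def Int_absorb2)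
  then show ?thesis
    using sum_degree[OF assms order_refl] by simp
qed

lemma ex_even_degree:
  assumes "finite_simple_graph G" "odd (card (verts G))"
  obtains v where "v \<in> verts G" "even (degree G v)"
proof -
  have "\<exists>v\<in>verts G. even (degree G v)"
  proof (rule ccontr)
    assume "\<not> (\<exists>v\<in>verts G. even (degree G v))"
    \<comment> \<open>This is the set that \<open>even_sum_iff\<close> counts: a sum is even iff it
      has an even number of odd terms.\<close>
    then have "{v \<in> verts G. odd (degree G v)} = verts G"
      by auto
    moreover have "finite (verts G)"
      using assms(1) by (simp add: finite_simple_graph_def)
    ultimately have "odd (\<Sum>v\<in>verts G. degree G v)"
      using assms(2) by (simp add: even_sum_iff)
    then show False
      by (simp add: handshake[OF assms(1)])
  qed
  then show thesis
    using that by blast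
qed

lemma bipartite_ex_odd_degree:
  assumes "finite_simple_graph G" "bipartite G" "odd (card (edges G))"
  obtains v where "v \<in> verts G" "odd (degree G v)"
proof -
  obtain A B where AB: "A \<union> B = verts G" "\<forall>e\<in>edges G. \<not> e \<subseteq> A \<and> \<not> e \<subseteq> B"
    using assms(2) by (auto simp: bipartite_def)
  have "card (e \<inter> A) = 1" if e: "e \<in> edges G" for e
  proof -
    have card_e: "card e = 2" and sub: "e \<subseteq> A \<union> B"
      using assms(1) e AB(1) by (auto simp: finite_simple_graph_def)
    \<comment> \<open>An infinite set has cardinality 0, not 2.\<close>
    then have "finite e"
      using card.infinite by fastforce
    \<comment> \<open>Nonempty because \<open>e\<close> is not inside \<open>B\<close>, proper
      because \<open>e\<close> is not inside \<open>A\<close>.\<close>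
    moreover have "e \<inter> A \<noteq> {}" "e \<inter> A \<subset> e"
      using AB(2) e sub by blast+
    ultimately have "0 < card (e \<inter> A)" "card (e \<inter> A) < 2"
      using psubset_card_mono[of e "e \<inter> A"] card_e by (auto simp: card_gt_0_iff)
    then show ?thesis
      by linarith
  qed
  then have "(\<Sum>v\<in>A. degree G v) = card (edges G)"
    using sum_degree[OF assms(1), of A] AB(1) by auto
  \<comment> \<open>If every degree on this side were even, \<open>dvd_sum\<close> would make the
    number of edges even.\<close>
  then obtain v where "v \<in> A" "odd (degree G v)"
    using assms(3) dvd_sum by metis
  then show thesis
    using that AB(1) by blast
qed

lemma card_edges_delete_vertex:
  assumes "finite_simple_graph G"
  shows "card (edges (delete_vertex G v)) + degree G v = card (edges G)"
proof -
  have "edges G = {e \<in> edges G. v \<notin> e} \<union> {e \<in> edges G. v \<in> e}"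
    by auto
  then have "card (edges G) = card {e \<in> edges G. v \<notin> e} + card {e \<in> edges G. v \<in> e}"
    using finite_edges[OF assms] card_Un_disjoint[of "{e \<in> edges G. v \<notin> e}" "{e \<in> edges G. v \<in> e}"]
    by fastforce
  then show ?thesis
    by (simp add: delete_vertex_def degree_def)
qed

text \<open>Both sides of a bipartition of \<open>G\<close> can be cut down to the vertices of
  \<open>H\<close>. This keeps the induction over moves inside the bipartite graphs.\<close>

lemma bipartite_subgraph:
  assumes "bipartite G" "verts H \<subseteq> verts G" "edges H \<subseteq> edges G"
  shows "bipartite H"
proof -
  obtain A B where AB: "A \<union> B = verts G" "A \<inter> B = {}"
    "\<forall>e\<in>edges G. \<not> e \<subseteq> A \<and> \<not> e \<subseteq> B"
    using assms(1) by (auto simp: bipartite_def)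
  have "A \<inter> verts H \<union> B \<inter> verts H = verts H"
    using AB(1) assms(2) by blast
  moreover have "A \<inter> verts H \<inter> (B \<inter> verts H) = {}"
    using AB(2) by blast
  moreover have "\<forall>e\<in>edges H. \<not> e \<subseteq> A \<inter> verts H \<and> \<not> e \<subseteq> B \<inter> verts H"
    using AB(3) assms(3) by (meson Int_subset_iff subsetD)
  ultimately show ?thesis
    unfolding bipartite_def by blast
qed

lemma bipartite_chomp_moves:
  assumes "bipartite G" "H \<in> chomp_moves G"
  shows "bipartite H"
  using assms(1)
proof (rule bipartite_subgraph)
  show "verts H \<subseteq> verts G" "edges H \<subseteq> edges G"
    using assms(2) by (auto simp: chomp_moves_def delete_edge_def delete_vertex_def)
qed

lemma mex_equality:
  assumes "n \<notin> S" "\<And>m. m < n \<Longrightarrow> m \<in> S"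
  shows "mex S = n"
  unfolding mex_def using assms by (intro Least_equality) (auto simp: not_less[symmetric])

text \<open>The two parities serve as binary digits, so two graphs agree in this value iff both of
  their parities agree.\<close>

definition parity_value :: "'a graph \<Rightarrow> nat" where
  "parity_value G = card (verts G) mod 2 + 2 * (card (edges G) mod 2)"

lemma parity_value_delete_edge:
  assumes "finite_simple_graph G" "e \<in> edges G"
  shows "parity_value (delete_edge G e) =
         card (verts G) mod 2 + 2 * (Suc (card (edges G)) mod 2)"
proof -
  have "card (edges G) = Suc (card (edges G - {e}))"
    using assms finite_edges by (metis card.remove)
  then show ?thesis
    by (simp add: parity_value_def delete_edge_def)
qed

lemma parity_value_delete_vertex:
  assumes "finite_simple_graph G" "v \<in> verts G"
  shows "parity_value (delete_vertex G v) =
         Suc (card (verts G)) mod 2 + 2 * ((card (edges G) + degree G v) mod 2)"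
proof -
  have "card (verts G) = Suc (card (verts G - {v}))"
    using assms by (metis card.remove finite_simple_graph_def)
  \<comment> \<open>Modulo 2, adding the degree is the same as subtracting it, which avoids
    truncated subtraction.\<close>
  moreover have "card (edges G) + degree G v = card (edges (delete_vertex G v)) + 2 * degree G v"
    using card_edges_delete_vertex[OF assms(1), of v] by simp
  ultimately show ?thesis
    by (simp add: parity_value_def delete_vertex_def mod2_eq_if)
qed

lemma parity_value_chomp_moves_neq:
  assumes "finite_simple_graph G" "H \<in> chomp_moves G"
  shows "parity_value H \<noteq> parity_value G"
proof -
  consider e where "e \<in> edges G" "H = delete_edge G e"
    | v where "v \<in> verts G" "H = delete_vertex G v"
    using assms(2) by (auto simp: chomp_moves_def)
  then show ?thesis
  proof cases
    case 1
    then show ?thesis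
      using parity_value_delete_edge[OF assms(1) 1(1)] by (simp add: parity_value_def mod2_eq_if)
  next
    case 2
    then show ?thesis
      using parity_value_delete_vertex[OF assms(1) 2(1)] by (auto simp: parity_value_def mod2_eq_if)
  qed
qed

lemma parity_value_less_reachable:
  assumes G: "finite_simple_graph G" "bipartite G" and m: "m < parity_value G"
  shows "m \<in> parity_value ` chomp_moves G"
proof -
  have edge: "\<exists>H\<in>chomp_moves G. parity_value H = card (verts G) mod 2"
    if e_odd: "odd (card (edges G))"
  proof -
    obtain e where e: "e \<in> edges G"
      using e_odd by fastforce
    then show ?thesis
      using parity_value_delete_edge[OF G(1) e] e_odd by (auto simp: chomp_moves_def)
  qed
  have even_deg: "\<exists>H\<in>chomp_moves G. parity_value H = 2 * (card (edges G) mod 2)"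
    if v_odd: "odd (card (verts G))"
  proof -
    obtain v where v: "v \<in> verts G" "even (degree G v)"
      using ex_even_degree[OF G(1) v_odd] .
    have "parity_value (delete_vertex G v) = 2 * (card (edges G) mod 2)"
      using parity_value_delete_vertex[OF G(1) v(1)] v_odd v(2) by (simp add: mod2_eq_if)
    then show ?thesis
      using v(1) by (auto simp: chomp_moves_def)
  qed
  have odd_deg: "\<exists>H\<in>chomp_moves G. parity_value H = Suc (card (verts G)) mod 2"
    if e_odd: "odd (card (edges G))"
  proof -
    obtain v where v: "v \<in> verts G" "odd (degree G v)"
      using bipartite_ex_odd_degree[OF G e_odd] .
    have "parity_value (delete_vertex G v) = Suc (card (verts G)) mod 2"
      using parity_value_delete_vertex[OF G(1) v(1)] e_odd v(2) by (simp add: mod2_eq_if)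
    then show ?thesis
      using v(1) by (auto simp: chomp_moves_def)
  qed
  \<comment> \<open>From value 1, \<open>even_deg\<close> reaches 0. From value 2,
    \<open>edge\<close> reaches 0 and \<open>odd_deg\<close> reaches 1. From value 3,
    \<open>edge\<close> reaches 1, \<open>even_deg\<close> reaches 2 and \<open>odd_deg\<close>
    reaches 0.\<close>
  have "odd (card (edges G)) \<and> m = card (verts G) mod 2 \<or>
        odd (card (verts G)) \<and> m = 2 * (card (edges G) mod 2) \<or>
        odd (card (edges G)) \<and> m = Suc (card (verts G)) mod 2"
    using m by (auto simp: parity_value_def mod2_eq_if split: if_splits)
  then show ?thesis
    using edge even_deg odd_deg by (metis image_eqI)
qed

text \<open>On bipartite graphs \<open>parity_value\<close> satisfies the same mex recursion as
  \<open>nim_value\<close>; induction on the number of vertices plus edges then identifies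
  them.\<close>

lemma nim_value_bipartite:
  assumes "finite_simple_graph G" "bipartite G"
  shows "nim_value G = parity_value G"
  using assms
proof (induction "card (verts G) + card (edges G)" arbitrary: G rule: less_induct)
  case less
  \<comment> \<open>The induction hypothesis covers every option, since a move yields a smaller
    graph that is again finite, simple and bipartite.\<close>
  have "nim_value ` chomp_moves G = parity_value ` chomp_moves G"
    using less.hyps chomp_moves_decrease[OF less.prems(1)]
      finite_simple_graph_chomp_moves[OF less.prems(1)] bipartite_chomp_moves[OF less.prems(2)]
    by (intro image_cong refl) blast
  moreover have "parity_value G \<notin> parity_value ` chomp_moves G"
    using parity_value_chomp_moves_neq[OF less.prems(1)] by fastforce
  ultimately show ?case
    using nim_value_rec[OF less.prems(1)] mex_equality
      parity_value_less_reachable[OF less.prems] by metis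
qed

theorem theorem3:
  fixes G :: "'a graph"
  assumes "finite_simple_graph G" and "bipartite G"
  shows "(even (card (verts G)) \<and> even (card (edges G)) \<longrightarrow> nim_value G = 0) \<and>
         (even (card (verts G)) \<and> odd (card (edges G)) \<longrightarrow> nim_value G = 2) \<and>
         (odd (card (verts G)) \<and> even (card (edges G)) \<longrightarrow> nim_value G = 1) \<and>
         (odd (card (verts G)) \<and> odd (card (edges G)) \<longrightarrow> nim_value G = 3)"
  using nim_value_bipartite[OF assms] by (simp add: parity_value_def mod2_eq_if)

end
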